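(* There exists a universal constant $c > 0$ such that for every $n$ and every $n\times n$ matrix $A$ with complex entries that is a $(q,k,t)$-design matrix with $q,k,t$ positive integers, $$\operatorname{rank}(A) \;\ge\; c\,\frac{k^4}{n t^3}.$$
   Context: For a vector $v \in \mathbb{C}^N$, $\operatorname{supp}(v) = \{i : v_i \neq 0\}$. An $m\times n$ matrix $A$ over $\mathbb{C}$ with rows $R_1,\dots,R_m$ and columns $C_1,\dots,C_n$ is a $(q,k,t)$-design matrix if: (1) $|\operatorname{supp}(R_i)| \le q$ for all $i \in [m]$; (2) $|\operatorname{supp}(C_j)| \ge k$ for all $j \in [n]$; (3) $|\operatorname{supp}(C_{j_1}) \cap \operatorname{supp}(C_{j_2})| \le t$ for all $j_1 \ne j_2 \in [n]$. *)

theory Defs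
  imports Complex_Main "Jordan_Normal_Form.Matrix" "Jordan_Normal_Form.DL_Rank"
begin

definition supp :: "complex vec \<Rightarrow> nat set" where
  "supp v = {i. i < dim_vec v \<and> v $ i \<noteq> 0}"

text \<open>Row and column indices run over $\{0,\dots,m-1\}$ and $\{0,\dots,n-1\}$, where
  $m$ and $n$ are the dimensions of the matrix.\<close>

definition design_matrix :: "nat \<Rightarrow> nat \<Rightarrow> nat \<Rightarrow> complex mat \<Rightarrow> bool" where
  "design_matrix q k t A \<longleftrightarrow>
     (\<forall>i < dim_row A. card (supp (row A i)) \<le> q) \<and>
     (\<forall>j < dim_col A. k \<le> card (supp (col A j))) \<and>
     (\<forall>j1 < dim_col A. \<forall>j2 < dim_col A. j1 \<noteq> j2 \<longrightarrow>
        card (supp (col A j1) \<inter> supp (col A j2)) \<le> t)"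

text \<open>The first argument of the library's rank function is the dimension of the ambient
  space of the columns, i.e. the number of rows.\<close>

abbreviation mat_rank :: "complex mat \<Rightarrow> nat" where
  "mat_rank A \<equiv> vec_space.rank (dim_row A) A"

end

(*
  If A has rank r, its Gram matrix G is a sum of r matrices of rank one, so (tr G)^2 <= r |G|_F^2.
  Rescaling rows and columns of A preserves its factorization through r dimensions, hence this
  bound on r, and the scaling is chosen to balance G.  Put weight 1 / |supp C_j| on each nonzero
  entry of column C_j.  The convex potential  sum (|A_ij|^2 e^(x_i + y_j) - w_ij (x_i + y_j))  is
  bounded below, and at any point close enough to its infimum the row and column sums of the
  scaled |A_ij|^2 agree with those of w up to constant factors and small errors: otherwise doubling
  or halving one row or column would lower the potential too much.  No exact minimizer, which may
  not exist, is needed.  The column sums are then about 1, and the design property bounds both the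
  row sums in l^2 and the off-diagonal part of G, which gives r >= k^2 / (152 t^2).  Double
  counting gives k^2 <= 2 n t, so this is stronger than the claim.
*)
theory Submission
  imports Defs "HOL-Analysis.Convex"
begin

section \<open>Rank factorization and the trace inequality for Gram matrices\<close>

text \<open>A maximal independent set of columns spans every column, and \<open>c\<close> collects
  the coordinates. The entrywise form lets later row and column scalings be absorbed into the two
  factors.\<close>

lemma low_rank_factorization:
  fixes A :: "complex mat"
  assumes A: "A \<in> carrier_mat n m"
  obtains S :: "complex vec set" and c :: "complex vec \<Rightarrow> nat \<Rightarrow> complex"
  where "finite S" "card S = vec_space.rank n A"
    "\<And>i j. i < n \<Longrightarrow> j < m \<Longrightarrow> A $$ (i, j) = (\<Sum>v\<in>S. v $ i * c v j)"
proof -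
  interpret vec_space "TYPE(complex)" n .
  have cols: "set (cols A) \<subseteq> carrier_vec n"
    using cols_dim A by blast
  obtain S where S: "finite S" "maximal S (\<lambda>T. T \<subseteq> set (cols A) \<and> lin_indpt T)"
    using maximal_exists_superset[of "set (cols A)" "\<lambda>T. T \<subseteq> set (cols A) \<and> lin_indpt T" "{}"]
    by (metis (no_types, lifting) List.finite_set empty_subsetI finite_lin_indpt2 empty_iff finite.emptyI)
  have sub: "S \<subseteq> set (cols A)" and ind: "lin_indpt S"
    using S(2) by (auto simp: maximal_def)
  have SV: "S \<subseteq> carrier_vec n" using sub cols by blast
  have inspan: "v \<in> span S" if v: "v \<in> set (cols A)" for v
  proof (rule ccontr)
    \<comment> \<open>A column outside the span could be added to \<open>S\<close> without losing
      independence, against maximality.\<close>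
    assume nin: "v \<notin> span S"
    have vV: "v \<in> carrier_vec n" using v cols by blast
    have "v \<notin> S" using nin span_mem[OF SV] by blast
    moreover have "lin_indpt (S \<union> {v})"
      using lin_dep_iff_in_span[of S v] SV ind vV nin \<open>v \<notin> S\<close> by auto
    ultimately show False
      using S(2) sub v unfolding maximal_def by (metis Un_insert_right Un_subset_iff
          empty_subsetI insertI1 insert_subset subset_insertI sup_bot.right_neutral)
  qed
  have "\<exists>a. v = lincomb a S" if "v \<in> set (cols A)" for v
    using inspan[OF that] finite_span[OF S(1) SV] by auto
  then obtain a where a: "v = lincomb (a v) S" if "v \<in> set (cols A)" for v
    by metis
  show thesis
  proof (rule that[of S "\<lambda>v j. a (col A j) v"])
    show "finite S" by (rule S(1))
    show "card S = rank A" using rank_card_indpt[OF A S(2)] by simp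
    fix i j assume ij: "i < n" "j < m"
    have mem: "col A j \<in> set (cols A)" using ij A by (auto simp: cols_def)
    have "A $$ (i, j) = col A j $ i" using ij A by auto
    also have "\<dots> = lincomb (a (col A j)) S $ i" using a[OF mem] by simp
    also have "\<dots> = (\<Sum>v\<in>S. a (col A j) v * v $ i)"
      by (rule lincomb_index[OF ij(1) SV])
    finally show "A $$ (i, j) = (\<Sum>v\<in>S. v $ i * a (col A j) v)"
      by (simp add: mult.commute)
  qed
qed

text \<open>Columns in the span of \<open>card L\<close> vectors have the inner products of suitable
  vectors with \<open>L\<close>-indexed coordinates. The induction performs one Gram-Schmidt step:
  project away \<open>u m\<close> and record the component along it as coordinate
  \<open>m\<close>.\<close>

lemma gram_low_rank:
  fixes a :: "'i \<Rightarrow> 'j \<Rightarrow> complex" and u :: "'l \<Rightarrow> 'i \<Rightarrow> complex" and c :: "'l \<Rightarrow> 'j \<Rightarrow> complex"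
  assumes "finite L" "finite I"
    and "\<And>i j. i \<in> I \<Longrightarrow> j \<in> J \<Longrightarrow> a i j = (\<Sum>l\<in>L. u l i * c l j)"
  shows "\<exists>b. \<forall>j\<in>J. \<forall>j'\<in>J. (\<Sum>i\<in>I. a i j * cnj (a i j')) = (\<Sum>l\<in>L. b l j * cnj (b l j'))"
  using assms(1,3)
proof (induction L arbitrary: a u rule: finite_induct)
  case empty
  then show ?case by simp
next
  case (insert m L)
  define s where "s = (\<Sum>i\<in>I. (cmod (u m i))\<^sup>2)"
  define p where "p = (\<lambda>j. \<Sum>i\<in>I. a i j * cnj (u m i))"
  define d where "d = (\<lambda>l. \<Sum>i\<in>I. u l i * cnj (u m i))"
  \<comment> \<open>The parts of the columns and of each \<open>u l\<close> orthogonal to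
    \<open>u m\<close>. If \<open>s = 0\<close>, division by zero gives 0 and nothing is subtracted,
    which is consistent because \<open>u m\<close> then vanishes on \<open>I\<close>.\<close>
  define a' where "a' = (\<lambda>i j. a i j - p j / s * u m i)"
  define u' where "u' = (\<lambda>l i. u l i - d l / s * u m i)"
  have dm: "d m = s"
    by (simp add: d_def s_def complex_norm_square del: of_real_power)
  have p: "p j = (\<Sum>l\<in>insert m L. d l * c l j)" if "j \<in> J" for j
  proof -
    have "p j = (\<Sum>i\<in>I. \<Sum>l\<in>insert m L. u l i * c l j * cnj (u m i))"
      unfolding p_def using insert.prems that by (simp add: sum_distrib_right)
    also have "\<dots> = (\<Sum>l\<in>insert m L. \<Sum>i\<in>I. u l i * c l j * cnj (u m i))"
      by (rule sum.swap)
    also have "\<dots> = (\<Sum>l\<in>insert m L. d l * c l j)"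
      unfolding d_def by (intro sum.cong refl) (simp add: sum_distrib_left mult_ac)
    finally show ?thesis .
  qed
  have zero: "u m i = 0" if "s = 0" "i \<in> I" for i
    using that assms(2) unfolding s_def by (subst (asm) sum_nonneg_eq_0_iff) auto
  have um: "u' m i = 0" if "i \<in> I" for i
    using zero[OF _ that] by (cases "s = 0") (auto simp: u'_def dm)
  \<comment> \<open>The projection is linear, so it acts on the factorization term by term, and it
    kills the term of \<open>m\<close>.\<close>
  have a': "a' i j = (\<Sum>l\<in>L. u' l i * c l j)" if "i \<in> I" "j \<in> J" for i j
  proof -
    have "a' i j = (\<Sum>l\<in>insert m L. u l i * c l j) - (\<Sum>l\<in>insert m L. d l * c l j) / s * u m i"
      unfolding a'_def p[OF that(2)] using insert.prems that by simp
    also have "\<dots> = (\<Sum>l\<in>insert m L. u' l i * c l j)"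
      unfolding u'_def
      by (simp only: sum_divide_distrib sum_distrib_right sum_subtractf[symmetric])
         (intro sum.cong refl, simp add: algebra_simps)
    also have "\<dots> = (\<Sum>l\<in>L. u' l i * c l j)"
      using insert.hyps um[OF that(1)] by simp
    finally show ?thesis .
  qed
  obtain b where b: "\<And>j j'. j \<in> J \<Longrightarrow> j' \<in> J \<Longrightarrow>
      (\<Sum>i\<in>I. a' i j * cnj (a' i j')) = (\<Sum>l\<in>L. b l j * cnj (b l j'))"
    using insert.IH[of a' u'] a' by blast
  \<comment> \<open>The new coordinate is the one along the unit vector
    \<open>u m / sqrt s\<close>.\<close>
  define b' where "b' = (\<lambda>l j. if l = m then p j / complex_of_real (sqrt s) else b l j)"
  have s0: "s \<ge> 0" unfolding s_def by (intro sum_nonneg) auto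
  \<comment> \<open>Pythagoras: removing the component along \<open>u m\<close> lowers the Gram
    matrix by a term of rank at most one.\<close>
  have G: "(\<Sum>i\<in>I. a i j * cnj (a i j')) = (\<Sum>i\<in>I. a' i j * cnj (a' i j')) + p j * cnj (p j') / s"
    for j j'
  proof (cases "s = 0")
    case True
    then show ?thesis by (simp add: a'_def)
  next
    case False
    have pj: "(\<Sum>i\<in>I. a i j * cnj (u m i)) = p j"
      by (simp add: p_def)
    have cp: "(\<Sum>i\<in>I. u m i * cnj (a i j')) = cnj (p j')"
      by (simp add: p_def mult.commute)
    have cs: "(\<Sum>i\<in>I. u m i * cnj (u m i)) = s"
      by (simp add: s_def complex_norm_square del: of_real_power)
    have "(\<Sum>i\<in>I. a' i j * cnj (a' i j')) = (\<Sum>i\<in>I. a i j * cnj (a i j')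
       - cnj (p j') / s * (a i j * cnj (u m i)) - p j / s * (u m i * cnj (a i j'))
       + p j / s * (cnj (p j') / s) * (u m i * cnj (u m i)))"
      unfolding a'_def by (intro sum.cong refl) (simp add: algebra_simps)
    also have "\<dots> = (\<Sum>i\<in>I. a i j * cnj (a i j'))
       - cnj (p j') / s * (\<Sum>i\<in>I. a i j * cnj (u m i))
       - p j / s * (\<Sum>i\<in>I. u m i * cnj (a i j'))
       + p j / s * (cnj (p j') / s) * (\<Sum>i\<in>I. u m i * cnj (u m i))"
      by (simp only: sum.distrib sum_subtractf sum_distrib_left)
    also have "\<dots> = (\<Sum>i\<in>I. a i j * cnj (a i j')) - cnj (p j') / s * p j - p j / s * cnj (p j')
       + p j / s * (cnj (p j') / s) * s"
      by (simp only: cp cs pj)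
    also have "\<dots> = (\<Sum>i\<in>I. a i j * cnj (a i j')) - p j * cnj (p j') / s"
      using False by simp
    finally show ?thesis by simp
  qed
  have "(\<Sum>i\<in>I. a i j * cnj (a i j')) = (\<Sum>l\<in>insert m L. b' l j * cnj (b' l j'))"
    if "j \<in> J" "j' \<in> J" for j j'
  proof -
    have "(\<Sum>l\<in>L. b' l j * cnj (b' l j')) = (\<Sum>l\<in>L. b l j * cnj (b l j'))"
      using insert.hyps by (intro sum.cong) (auto simp: b'_def)
    moreover have "b' m j * cnj (b' m j') = p j * cnj (p j') / s"
      using s0 by (simp add: b'_def flip: of_real_mult)
    ultimately show ?thesis
      using insert.hyps by (simp add: G b[OF that])
  qed
  then show ?case by blast
qed

text \<open>The Gram matrix over \<open>J\<close> and the matrix \<open>h\<close> over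
  \<open>L\<close> have the same trace and the same Frobenius norm. Cauchy-Schwarz on the
  \<open>card L\<close> diagonal entries of \<open>h\<close> bounds the squared trace, and
  off-diagonal entries only increase the norm.\<close>

lemma trace_sq_le_rank_frobenius:
  fixes a :: "'i \<Rightarrow> 'j \<Rightarrow> complex" and u :: "'l \<Rightarrow> 'i \<Rightarrow> complex" and c :: "'l \<Rightarrow> 'j \<Rightarrow> complex"
  assumes fin: "finite L" "finite I"
    and a: "\<And>i j. i \<in> I \<Longrightarrow> j \<in> J \<Longrightarrow> a i j = (\<Sum>l\<in>L. u l i * c l j)"
  shows "(\<Sum>j\<in>J. \<Sum>i\<in>I. (cmod (a i j))\<^sup>2)\<^sup>2
    \<le> card L * (\<Sum>j\<in>J. \<Sum>j'\<in>J. (cmod (\<Sum>i\<in>I. a i j * cnj (a i j')))\<^sup>2)"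
proof -
  obtain b where b: "\<And>j j'. j \<in> J \<Longrightarrow> j' \<in> J \<Longrightarrow>
      (\<Sum>i\<in>I. a i j * cnj (a i j')) = (\<Sum>l\<in>L. b l j * cnj (b l j'))"
    using gram_low_rank[of L I J a u c, OF fin a] by blast
  define h where "h = (\<lambda>l m. \<Sum>j\<in>J. b l j * cnj (b m j))"
  define d where "d = (\<lambda>l. \<Sum>j\<in>J. (cmod (b l j))\<^sup>2)"
  have hd: "h l l = d l" for l
    by (simp add: h_def d_def complex_norm_square del: of_real_power)
  have d0: "d l \<ge> 0" for l unfolding d_def by (intro sum_nonneg) auto
  have "(\<Sum>j\<in>J. \<Sum>i\<in>I. (cmod (a i j))\<^sup>2) = (\<Sum>j\<in>J. \<Sum>l\<in>L. (cmod (b l j))\<^sup>2)"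
  proof (rule sum.cong[OF refl])
    fix j assume j: "j \<in> J"
    have "complex_of_real (\<Sum>i\<in>I. (cmod (a i j))\<^sup>2) = complex_of_real (\<Sum>l\<in>L. (cmod (b l j))\<^sup>2)"
      using b[OF j j] by (simp add: complex_norm_square del: of_real_power)
    then show "(\<Sum>i\<in>I. (cmod (a i j))\<^sup>2) = (\<Sum>l\<in>L. (cmod (b l j))\<^sup>2)"
      using of_real_eq_iff by blast
  qed
  also have "\<dots> = (\<Sum>l\<in>L. d l)"
    unfolding d_def by (rule sum.swap)
  finally have T: "(\<Sum>j\<in>J. \<Sum>i\<in>I. (cmod (a i j))\<^sup>2) = (\<Sum>l\<in>L. d l)" .
  have "complex_of_real (\<Sum>j\<in>J. \<Sum>j'\<in>J. (cmod (\<Sum>i\<in>I. a i j * cnj (a i j')))\<^sup>2)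
      = (\<Sum>j\<in>J. \<Sum>j'\<in>J. (\<Sum>l\<in>L. b l j * cnj (b l j')) * cnj (\<Sum>m\<in>L. b m j * cnj (b m j')))"
    unfolding of_real_sum complex_norm_square by (intro sum.cong refl) (simp only: b)
  also have "\<dots> = (\<Sum>j\<in>J. \<Sum>j'\<in>J. \<Sum>l\<in>L. \<Sum>m\<in>L. (b l j * cnj (b m j)) * cnj (b l j' * cnj (b m j')))"
    by (intro sum.cong refl) (simp add: sum_product mult_ac)
  also have "\<dots> = (\<Sum>l\<in>L. \<Sum>m\<in>L. \<Sum>j\<in>J. \<Sum>j'\<in>J. (b l j * cnj (b m j)) * cnj (b l j' * cnj (b m j')))"
    by (simp only: sum.swap[of _ L J])
  also have "\<dots> = (\<Sum>l\<in>L. \<Sum>m\<in>L. h l m * cnj (h l m))"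
    unfolding h_def cnj_sum sum_product ..
  also have "\<dots> = complex_of_real (\<Sum>l\<in>L. \<Sum>m\<in>L. (cmod (h l m))\<^sup>2)"
    by (simp add: complex_norm_square del: of_real_power)
  finally have F: "(\<Sum>j\<in>J. \<Sum>j'\<in>J. (cmod (\<Sum>i\<in>I. a i j * cnj (a i j')))\<^sup>2)
      = (\<Sum>l\<in>L. \<Sum>m\<in>L. (cmod (h l m))\<^sup>2)"
    using of_real_eq_iff by blast
  have "(\<Sum>l\<in>L. d l)\<^sup>2 \<le> card L * (\<Sum>l\<in>L. (d l)\<^sup>2)"
    using sum_squared_le_sum_of_squares[of d L] by (simp add: mult.commute)
  also have "(\<Sum>l\<in>L. (d l)\<^sup>2) \<le> (\<Sum>l\<in>L. \<Sum>m\<in>L. (cmod (h l m))\<^sup>2)"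
  proof (rule sum_mono)
    fix l assume "l \<in> L"
    have "(d l)\<^sup>2 = (cmod (h l l))\<^sup>2" using d0 by (simp add: hd)
    also have "\<dots> \<le> (\<Sum>m\<in>L. (cmod (h l m))\<^sup>2)"
      using \<open>l \<in> L\<close> fin by (intro member_le_sum) auto
    finally show "(d l)\<^sup>2 \<le> (\<Sum>m\<in>L. (cmod (h l m))\<^sup>2)" .
  qed
  finally show ?thesis
    unfolding T F by (simp add: mult_left_mono)
qed

section \<open>Approximate matrix scaling through a convex potential\<close>

text \<open>Serves to make \<open>ln 2 - 1 / 10\<close> at least \<open>1 / 2\<close>, the lower
  bound for scaled column sums.\<close>

lemma ln_2_ge_three_fifths: "3 / 5 \<le> ln (2::real)"
proof -
  have "exp (3::real) = exp 1 ^ 3" by (simp flip: exp_of_nat_mult)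
  also have "\<dots> \<le> 3 ^ 3" using exp_le by (intro power_mono) auto
  also have "\<dots> \<le> (2::real) ^ 5" by simp
  finally have "3 \<le> ln ((2::real) ^ 5)" by (subst ln_ge_iff) auto
  then show ?thesis by (simp only: ln_realpow)
qed

text \<open>The derivative in \<open>x i\<close> is the \<open>i\<close>-th row sum of
  \<open>B i j * exp (x i + y j)\<close> minus that of \<open>w\<close>, and similarly for
  \<open>y j\<close>. Stationary points are thus the exact scalings of \<open>B\<close> to the row
  and column sums of \<open>w\<close>.\<close>

definition scaling_potential ::
  "'i set \<Rightarrow> 'j set \<Rightarrow> ('i \<Rightarrow> 'j \<Rightarrow> real) \<Rightarrow> ('i \<Rightarrow> 'j \<Rightarrow> real) \<Rightarrow> ('i \<Rightarrow> real) \<Rightarrow> ('j \<Rightarrow> real) \<Rightarrow> real" where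
  "scaling_potential I J B w x y = (\<Sum>i\<in>I. \<Sum>j\<in>J. B i j * exp (x i + y j) - w i j * (x i + y j))"

lemma scaling_potential_swap:
  "scaling_potential I J B w x y = scaling_potential J I (\<lambda>j i. B i j) (\<lambda>j i. w i j) y x"
  unfolding scaling_potential_def by (subst sum.swap) (simp add: add.commute)

lemma scaling_potential_shift:
  assumes "finite I" "i \<in> I"
  shows "scaling_potential I J B w (x(i := x i + s)) y = scaling_potential I J B w x y
    + (exp s - 1) * (\<Sum>j\<in>J. B i j * exp (x i + y j)) - s * (\<Sum>j\<in>J. w i j)"
proof -
  have "(\<Sum>j\<in>J. B i j * exp (x i + s + y j) - w i j * (x i + s + y j))
      = (\<Sum>j\<in>J. (B i j * exp (x i + y j) - w i j * (x i + y j))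
          + (exp s - 1) * (B i j * exp (x i + y j)) - s * w i j)"
    by (intro sum.cong refl) (simp add: algebra_simps exp_add)
  also have "\<dots> = (\<Sum>j\<in>J. B i j * exp (x i + y j) - w i j * (x i + y j))
      + (exp s - 1) * (\<Sum>j\<in>J. B i j * exp (x i + y j)) - s * (\<Sum>j\<in>J. w i j)"
    by (simp only: sum.distrib sum_subtractf sum_distrib_left)
  finally show ?thesis
    unfolding scaling_potential_def using assms by (simp add: sum.remove[of I i])
qed

text \<open>For \<open>w i j > 0\<close> a summand is smallest where
  \<open>exp (x i + y j) = w i j / B i j\<close>, by the tangent inequality for \<open>exp\<close>;
  for \<open>w i j = 0\<close> it is nonnegative. The support condition excludes purely linear
  summands, which are unbounded below.\<close>

lemma scaling_potential_bounded_below: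
  assumes "\<And>i j. i \<in> I \<Longrightarrow> j \<in> J \<Longrightarrow> 0 \<le> B i j \<and> 0 \<le> w i j \<and> (w i j > 0 \<longrightarrow> B i j > 0)"
  shows "(\<Sum>i\<in>I. \<Sum>j\<in>J. w i j * (1 - ln (w i j / B i j))) \<le> scaling_potential I J B w x y"
  unfolding scaling_potential_def
proof (intro sum_mono)
  fix i j assume ij: "i \<in> I" "j \<in> J"
  show "w i j * (1 - ln (w i j / B i j)) \<le> B i j * exp (x i + y j) - w i j * (x i + y j)"
  proof (cases "w i j = 0")
    case True
    then show ?thesis using assms[OF ij] by simp
  next
    case False
    then have pos: "w i j > 0" "B i j > 0" using assms[OF ij] by auto
    have "w i j * (1 + (x i + y j - ln (w i j / B i j))) \<le> w i j * exp (x i + y j - ln (w i j / B i j))"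
      using pos by (intro mult_left_mono exp_ge_add_one_self) auto
    also have "\<dots> = B i j * exp (x i + y j)"
      using pos by (simp add: exp_diff)
    finally show ?thesis by (simp add: algebra_simps)
  qed
qed

text \<open>Doubling row \<open>i\<close> must not gain more than \<open>\<delta>\<close>, which
  bounds its sum from below; halving it gives the bound from above.\<close>

lemma near_minimizer_row_sum:
  assumes "finite I" "i \<in> I"
    and min: "\<And>x'. scaling_potential I J B w x y \<le> scaling_potential I J B w x' y + \<delta>"
  shows "(\<Sum>j\<in>J. w i j) * ln 2 - \<delta> \<le> (\<Sum>j\<in>J. B i j * exp (x i + y j))"
    and "(\<Sum>j\<in>J. B i j * exp (x i + y j)) \<le> 2 * (\<Sum>j\<in>J. w i j) * ln 2 + 2 * \<delta>"
proof -
  note shift = scaling_potential_shift[OF assms(1,2), of J B w x _ y]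
  show "(\<Sum>j\<in>J. w i j) * ln 2 - \<delta> \<le> (\<Sum>j\<in>J. B i j * exp (x i + y j))"
    using min[of "x(i := x i + ln 2)"] unfolding shift by (simp add: mult.commute)
  have half: "exp (- ln 2 :: real) - 1 = - 1 / 2" by (simp add: exp_minus)
  show "(\<Sum>j\<in>J. B i j * exp (x i + y j)) \<le> 2 * (\<Sum>j\<in>J. w i j) * ln 2 + 2 * \<delta>"
    using min[of "x(i := x i + (- ln 2))"] unfolding shift half by (simp add: field_simps)
qed

text \<open>The infimum of the potential is finite, so some point lies within
  \<open>\<delta>\<close> of it. There no change of a single row or column gains more than
  \<open>\<delta>\<close>.\<close>

lemma approximate_scaling:
  fixes B w :: "'i \<Rightarrow> 'j \<Rightarrow> real"
  assumes fin: "finite I" "finite J" and \<delta>: "\<delta> > 0"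
    and pos: "\<And>i j. i \<in> I \<Longrightarrow> j \<in> J \<Longrightarrow> 0 \<le> B i j \<and> 0 \<le> w i j \<and> (w i j > 0 \<longrightarrow> B i j > 0)"
  shows "\<exists>x y.
    (\<forall>i\<in>I. (\<Sum>j\<in>J. B i j * exp (x i + y j)) \<le> 2 * (\<Sum>j\<in>J. w i j) * ln 2 + 2 * \<delta>) \<and>
    (\<forall>j\<in>J. (\<Sum>i\<in>I. B i j * exp (x i + y j)) \<le> 2 * (\<Sum>i\<in>I. w i j) * ln 2 + 2 * \<delta>) \<and>
    (\<forall>j\<in>J. (\<Sum>i\<in>I. w i j) * ln 2 - \<delta> \<le> (\<Sum>i\<in>I. B i j * exp (x i + y j)))"
proof -
  define R where "R = range (\<lambda>(x, y). scaling_potential I J B w x y)"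
  have bdd: "bdd_below R"
    unfolding R_def
    by (rule bdd_belowI2, unfold split_beta, rule scaling_potential_bounded_below[OF pos])
  have "R \<noteq> {}" by (simp add: R_def)
  then have "\<exists>r\<in>R. r < Inf R + \<delta>"
    using \<delta> cInf_less_iff[OF _ bdd, of "Inf R + \<delta>"] by simp
  then obtain x y where xy: "scaling_potential I J B w x y < Inf R + \<delta>"
    by (auto simp: R_def)
  have min: "scaling_potential I J B w x y \<le> scaling_potential I J B w x' y' + \<delta>" for x' y'
  proof -
    have "Inf R \<le> scaling_potential I J B w x' y'"
      by (intro cInf_lower bdd) (auto simp: R_def)
    then show ?thesis using xy by simp
  qed
  \<comment> \<open>Column sums are row sums of the transposed potential.\<close>
  have min': "scaling_potential J I (\<lambda>j i. B i j) (\<lambda>j i. w i j) y x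
      \<le> scaling_potential J I (\<lambda>j i. B i j) (\<lambda>j i. w i j) y' x + \<delta>" for y'
    using min[of x y'] unfolding scaling_potential_swap[of I J B w] .
  show ?thesis
  proof (intro exI conjI ballI)
    fix i assume "i \<in> I"
    then show "(\<Sum>j\<in>J. B i j * exp (x i + y j)) \<le> 2 * (\<Sum>j\<in>J. w i j) * ln 2 + 2 * \<delta>"
      by (rule near_minimizer_row_sum(2)[OF fin(1) _ min])
  next
    fix j assume "j \<in> J"
    note col = near_minimizer_row_sum[OF fin(2) this min', unfolded add.commute[of "y j"]]
    show "(\<Sum>i\<in>I. B i j * exp (x i + y j)) \<le> 2 * (\<Sum>i\<in>I. w i j) * ln 2 + 2 * \<delta>"
      by (rule col(2))
  next
    fix j assume "j \<in> J"
    note col = near_minimizer_row_sum[OF fin(2) this min', unfolded add.commute[of "y j"]]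
    show "(\<Sum>i\<in>I. w i j) * ln 2 - \<delta> \<le> (\<Sum>i\<in>I. B i j * exp (x i + y j))"
      by (rule col(1))
  qed
qed

section \<open>Estimates from small column intersections\<close>

text \<open>Cauchy-Schwarz on the common support, which has at most \<open>t\<close> elements. It
  controls the off-diagonal Gram entries.\<close>

lemma cmod_sum_mult_sq_le:
  assumes fin: "finite I" and t: "card {i \<in> I. f i \<noteq> 0 \<and> g i \<noteq> 0} \<le> t"
  shows "(cmod (\<Sum>i\<in>I. f i * cnj (g i)))\<^sup>2 \<le> t * (\<Sum>i\<in>I. (cmod (f i))\<^sup>2 * (cmod (g i))\<^sup>2)"
proof -
  let ?K = "{i \<in> I. f i \<noteq> 0 \<and> g i \<noteq> 0}"
  let ?S = "\<Sum>i\<in>?K. (cmod (f i * g i))\<^sup>2"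
  have "(\<Sum>i\<in>I. f i * cnj (g i)) = (\<Sum>i\<in>?K. f i * cnj (g i))"
    by (intro sum.mono_neutral_right) (auto simp: fin)
  then have "cmod (\<Sum>i\<in>I. f i * cnj (g i)) \<le> (\<Sum>i\<in>?K. cmod (f i * g i))"
    by (metis (no_types, lifting) norm_sum sum.cong norm_mult complex_mod_cnj)
  then have "(cmod (\<Sum>i\<in>I. f i * cnj (g i)))\<^sup>2 \<le> (\<Sum>i\<in>?K. cmod (f i * g i))\<^sup>2"
    by (intro power_mono) auto
  also have "\<dots> \<le> card ?K * ?S"
    using sum_squared_le_sum_of_squares[of "\<lambda>i. cmod (f i * g i)" ?K] by (simp add: mult.commute)
  also have "\<dots> \<le> t * ?S"
    using t by (intro mult_right_mono sum_nonneg) auto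
  also have "?S = (\<Sum>i\<in>I. (cmod (f i))\<^sup>2 * (cmod (g i))\<^sup>2)"
    unfolding norm_mult power_mult_distrib by (intro sum.mono_neutral_left) (auto simp: fin)
  finally show ?thesis .
qed

text \<open>Expanding the squares, the pair \<open>j\<close>, \<open>j'\<close> contributes
  \<open>card (S j \<inter> S j')\<close> over the product of both cardinalities: at most
  \<open>1 / k\<close> on the diagonal and \<open>t / k^2\<close> off it.\<close>

lemma sum_inverse_card_sq:
  fixes S :: "'j \<Rightarrow> 'i set"
  assumes fin: "finite I" "finite J" and S: "\<And>j. j \<in> J \<Longrightarrow> S j \<subseteq> I"
    and k: "k > 0" "\<And>j. j \<in> J \<Longrightarrow> k \<le> card (S j)"
    and t: "\<And>j j'. j \<in> J \<Longrightarrow> j' \<in> J \<Longrightarrow> j \<noteq> j' \<Longrightarrow> card (S j \<inter> S j') \<le> t"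
  shows "(\<Sum>i\<in>I. (\<Sum>j\<in>J. if i \<in> S j then 1 / real (card (S j)) else 0)\<^sup>2)
    \<le> real (card J) / k + (real (card J))\<^sup>2 * t / (real k)\<^sup>2"
proof -
  let ?w = "\<lambda>i j. if i \<in> S j then 1 / real (card (S j)) else 0"
  have "(\<Sum>i\<in>I. (\<Sum>j\<in>J. ?w i j)\<^sup>2) = (\<Sum>i\<in>I. \<Sum>j\<in>J. \<Sum>j'\<in>J. ?w i j * ?w i j')"
    unfolding power2_eq_square sum_product ..
  also have "\<dots> = (\<Sum>j\<in>J. \<Sum>j'\<in>J. \<Sum>i\<in>I. ?w i j * ?w i j')"
    by (subst sum.swap, intro sum.cong refl, rule sum.swap)
  \<comment> \<open>Granting \<open>t / k^2\<close> to diagonal pairs too makes the double sum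
    immediate to evaluate.\<close>
  also have "\<dots> \<le> (\<Sum>j\<in>J. \<Sum>j'\<in>J. (if j' = j then 1 / real k else 0) + real t / (real k)\<^sup>2)"
  proof (intro sum_mono)
    fix j j' assume j: "j \<in> J" and j': "j' \<in> J"
    have kj: "real k \<le> card (S j)" "real k \<le> card (S j')" using k j j' by auto
    have "(\<Sum>i\<in>I. ?w i j * ?w i j')
        = (\<Sum>i\<in>S j \<inter> S j'. 1 / (real (card (S j)) * real (card (S j'))))"
      using S[OF j] by (intro sum.mono_neutral_cong_right fin) auto
    also have "\<dots> = card (S j \<inter> S j') / (real (card (S j)) * real (card (S j')))"
      by simp
    also have "\<dots> \<le> (if j' = j then 1 / real k else 0) + real t / (real k)\<^sup>2"
    proof (cases "j' = j")
      case True
      have "card (S j) / (real (card (S j)) * real (card (S j))) = 1 / card (S j)"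
        by simp
      also have "\<dots> \<le> 1 / real k"
        using kj k(1) by (intro divide_left_mono) auto
      finally show ?thesis using True by (simp add: add_increasing2)
    next
      case False
      have "(real k)\<^sup>2 \<le> real (card (S j)) * real (card (S j'))"
        unfolding power2_eq_square using kj by (intro mult_mono) auto
      then show ?thesis
        using False t[OF j j'] k(1) by (auto intro!: frac_le)
    qed
    finally show "(\<Sum>i\<in>I. ?w i j * ?w i j')
        \<le> (if j' = j then 1 / real k else 0) + real t / (real k)\<^sup>2" .
  qed
  also have "\<dots> = card J / k + (real (card J))\<^sup>2 * t / (real k)\<^sup>2"
    using fin by (simp add: sum.distrib power2_eq_square distrib_left)
  finally show ?thesis .
qed

section \<open>The rank bound for design matrices\<close>

text \<open>Both bounds rest on \<open>n \<le> Q \<le> 2 * X\<close>. The outer inequality is the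
  first bound. For the second, the scaled Gram matrix has trace at least \<open>n / 2\<close> and
  squared Frobenius norm at most \<open>38 * t * X\<close>.\<close>

lemma design_matrix_rank_bound:
  fixes A :: "complex mat"
  assumes A: "A \<in> carrier_mat n n" and D: "design_matrix q k t A"
    and n: "n \<ge> 1" and k: "k \<ge> 1" and t: "t \<ge> 1"
  shows "(real k)\<^sup>2 \<le> 2 * n * t" and "(real k)\<^sup>2 \<le> 152 * (real t)\<^sup>2 * mat_rank A"
proof -
  define S where "S = (\<lambda>j. supp (col A j))"
  have S: "S j = {i. i < n \<and> A $$ (i, j) \<noteq> 0}" if "j < n" for j
    using that A by (auto simp: S_def supp_def)
  have Sn: "S j \<subseteq> {..<n}" if "j < n" for j using S[OF that] by auto
  have kS: "k \<le> card (S j)" if "j < n" for j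
    using D A that by (auto simp: design_matrix_def S_def)
  have tS: "card (S j \<inter> S j') \<le> t" if "j < n" "j' < n" "j \<noteq> j'" for j j'
    using D A that by (auto simp: design_matrix_def S_def)
  have "card (S 0) \<le> n" using card_mono[OF _ Sn[of 0]] n by simp
  then have kn: "k \<le> n" using kS[of 0] n by simp
  define w where "w = (\<lambda>i j. if i \<in> S j then 1 / real (card (S j)) else 0)"
  define \<rho> where "\<rho> = (\<lambda>i. \<Sum>j<n. w i j)"
  define Q where "Q = (\<Sum>i<n. (\<rho> i)\<^sup>2)"
  define X where "X = (real n)\<^sup>2 * t / (real k)\<^sup>2"
  have wcol: "(\<Sum>i<n. w i j) = 1" if "j < n" for j
  proof -
    have "(\<Sum>i<n. w i j) = (\<Sum>i\<in>S j. 1 / real (card (S j)))"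
      unfolding w_def using Sn[OF that] by (intro sum.mono_neutral_cong_right) auto
    then show ?thesis using kS[OF that] k by simp
  qed
  have \<rho>sum: "(\<Sum>i<n. \<rho> i) = n"
    unfolding \<rho>_def by (subst sum.swap) (simp add: wcol)
  have "Q \<le> real n / k + X"
    using sum_inverse_card_sq[of "{..<n}" "{..<n}" S k t] Sn kS tS k
    by (simp add: Q_def \<rho>_def w_def X_def)
  \<comment> \<open>This amounts to \<open>k \<le> n * t\<close>.\<close>
  also have "real n / k \<le> X"
  proof -
    have "real k \<le> real n * real t"
      using kn t by (metis le_trans mult.right_neutral mult_le_mono2 of_nat_le_iff of_nat_mult)
    then have "real n * k \<le> (real n)\<^sup>2 * t"
      using mult_left_mono[of "real k" "real n * real t" "real n"] by (simp add: power2_eq_square mult.assoc)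
    then have "real n * k / (real k)\<^sup>2 \<le> X"
      unfolding X_def by (rule divide_right_mono) simp
    then show ?thesis using k by (simp add: power2_eq_square)
  qed
  finally have QX: "Q \<le> 2 * X" by simp
  \<comment> \<open>Cauchy-Schwarz; the total weight is \<open>n\<close>, so this reads
    \<open>n^2 \<le> n * Q\<close>.\<close>
  have "(\<Sum>i<n. \<rho> i)\<^sup>2 \<le> n * Q"
    unfolding Q_def using sum_squared_le_sum_of_squares[of \<rho> "{..<n}"] by (simp add: mult.commute)
  then have nQ: "n \<le> Q"
    unfolding \<rho>sum using n by (simp add: power2_eq_square)
  have "real n \<le> 2 * X" using nQ QX by simp
  then have "real n * (real k)\<^sup>2 \<le> real n * (2 * n * t)"
    using k by (simp add: X_def field_simps power2_eq_square)
  then show "(real k)\<^sup>2 \<le> 2 * n * t" using n by simp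

  have pos: "0 \<le> (cmod (A $$ (i, j)))\<^sup>2 \<and> 0 \<le> w i j \<and> (w i j > 0 \<longrightarrow> (cmod (A $$ (i, j)))\<^sup>2 > 0)"
    if "i \<in> {..<n}" "j \<in> {..<n}" for i j
    using S that by (auto simp: w_def)
  \<comment> \<open>With column weights 1, this tolerance keeps column sums between
    \<open>1 / 2\<close> and 3, and row sums below \<open>2 * \<rho> i + 1\<close>.\<close>
  have tenth: "(0::real) < 1 / 10" by simp
  obtain x y where
    row: "\<forall>i\<in>{..<n}.
      (\<Sum>j<n. (cmod (A $$ (i, j)))\<^sup>2 * exp (x i + y j)) \<le> 2 * (\<Sum>j<n. w i j) * ln 2 + 2 * (1 / 10)"
    and col: "\<forall>j\<in>{..<n}.
      (\<Sum>i<n. (cmod (A $$ (i, j)))\<^sup>2 * exp (x i + y j)) \<le> 2 * (\<Sum>i<n. w i j) * ln 2 + 2 * (1 / 10)"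
    and col': "\<forall>j\<in>{..<n}.
      (\<Sum>i<n. w i j) * ln 2 - 1 / 10 \<le> (\<Sum>i<n. (cmod (A $$ (i, j)))\<^sup>2 * exp (x i + y j))"
    using approximate_scaling[where B = "\<lambda>i j. (cmod (A $$ (i, j)))\<^sup>2" and w = w,
        OF finite_lessThan finite_lessThan tenth pos] by blast
  \<comment> \<open>Half exponents, since \<open>a\<close> is squared below. The factors are
    nonzero, so supports are unchanged.\<close>
  define a where "a = (\<lambda>i j. of_real (exp (x i / 2)) * A $$ (i, j) * of_real (exp (y j / 2)))"
  have a2: "(cmod (a i j))\<^sup>2 = (cmod (A $$ (i, j)))\<^sup>2 * exp (x i + y j)" for i j
    by (simp add: a_def norm_mult power_mult_distrib exp_add flip: exp_of_nat_mult)
  define R where "R = (\<lambda>i. \<Sum>j<n. (cmod (a i j))\<^sup>2)"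
  define C where "C = (\<lambda>j. \<Sum>i<n. (cmod (a i j))\<^sup>2)"
  have \<rho>0: "\<rho> i \<ge> 0" for i unfolding \<rho>_def w_def by (intro sum_nonneg) auto
  have R0: "R i \<ge> 0" for i unfolding R_def by (intro sum_nonneg) auto
  note ln2 = ln_2_ge_three_fifths less_imp_le[OF ln_2_less_1]
  have R: "R i \<le> 2 * \<rho> i + 1" if "i < n" for i
  proof -
    have "\<rho> i * ln 2 \<le> \<rho> i" using ln2 \<rho>0[of i] mult_left_mono[of "ln 2" 1 "\<rho> i"] by simp
    then show ?thesis using bspec[OF row, of i] that by (simp add: R_def a2 \<rho>_def)
  qed
  have C: "1 / 2 \<le> C j" "C j \<le> 3" if "j < n" for j
    using bspec[OF col, of j] bspec[OF col', of j] that ln2 by (simp_all add: C_def a2 wcol)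
  have R2: "(\<Sum>i<n. (R i)\<^sup>2) \<le> 20 * X"
  proof -
    have "(\<Sum>i<n. (R i)\<^sup>2) \<le> (\<Sum>i<n. 8 * (\<rho> i)\<^sup>2 + 2)"
    proof (intro sum_mono)
      fix i assume "i \<in> {..<n}"
      then have "(R i)\<^sup>2 \<le> (2 * \<rho> i + 1)\<^sup>2" using R R0 by (intro power_mono) auto
      also have "\<dots> \<le> 8 * (\<rho> i)\<^sup>2 + 2"
        using zero_le_power2[of "2 * \<rho> i - 1"] by (simp add: power2_eq_square algebra_simps)
      finally show "(R i)\<^sup>2 \<le> 8 * (\<rho> i)\<^sup>2 + 2" .
    qed
    also have "\<dots> = 8 * Q + 2 * n"
      by (simp add: Q_def sum.distrib sum_distrib_left)
    finally show ?thesis using nQ QX by simp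
  qed
  \<comment> \<open>The 9 is the square of the bound 3 on column sums, needed only on the
    diagonal.\<close>
  have G: "(cmod (\<Sum>i<n. a i j * cnj (a i j')))\<^sup>2
      \<le> (if j' = j then 9 else 0) + t * (\<Sum>i<n. (cmod (a i j))\<^sup>2 * (cmod (a i j'))\<^sup>2)"
    if j: "j < n" and j': "j' < n" for j j'
  proof (cases "j' = j")
    case True
    have "(\<Sum>i<n. a i j * cnj (a i j)) = of_real (C j)"
      by (simp add: C_def complex_norm_square del: of_real_power)
    then have "(cmod (\<Sum>i<n. a i j * cnj (a i j)))\<^sup>2 \<le> 3\<^sup>2"
      using C[OF j] by (intro power_mono) auto
    moreover have "0 \<le> t * (\<Sum>i<n. (cmod (a i j))\<^sup>2 * (cmod (a i j'))\<^sup>2)"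
      by (intro mult_nonneg_nonneg sum_nonneg) auto
    ultimately show ?thesis using True by simp
  next
    case False
    have "{i \<in> {..<n}. a i j \<noteq> 0 \<and> a i j' \<noteq> 0} = S j \<inter> S j'"
      using S j j' by (auto simp: a_def)
    then show ?thesis
      using cmod_sum_mult_sq_le[of "{..<n}" "\<lambda>i. a i j" "\<lambda>i. a i j'" t] tS[OF j j'] False by simp
  qed
  have "(\<Sum>j<n. \<Sum>j'<n. (cmod (\<Sum>i<n. a i j * cnj (a i j')))\<^sup>2)
      \<le> (\<Sum>j<n. \<Sum>j'<n. (if j' = j then 9 else 0) + t * (\<Sum>i<n. (cmod (a i j))\<^sup>2 * (cmod (a i j'))\<^sup>2))"
    using G by (intro sum_mono) auto
  also have "\<dots> = 9 * n + t * (\<Sum>j<n. \<Sum>j'<n. \<Sum>i<n. (cmod (a i j))\<^sup>2 * (cmod (a i j'))\<^sup>2)"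
    by (simp add: sum.distrib sum_distrib_left)
  \<comment> \<open>Moving the row index outermost turns the triple sum into the squares of the row
    sums.\<close>
  also have "(\<Sum>j<n. \<Sum>j'<n. \<Sum>i<n. (cmod (a i j))\<^sup>2 * (cmod (a i j'))\<^sup>2)
      = (\<Sum>j<n. \<Sum>i<n. \<Sum>j'<n. (cmod (a i j))\<^sup>2 * (cmod (a i j'))\<^sup>2)"
    by (intro sum.cong refl sum.swap)
  also have "\<dots> = (\<Sum>i<n. \<Sum>j<n. \<Sum>j'<n. (cmod (a i j))\<^sup>2 * (cmod (a i j'))\<^sup>2)"
    by (rule sum.swap)
  also have "\<dots> = (\<Sum>i<n. (R i)\<^sup>2)"
    unfolding R_def power2_eq_square[of "sum _ _"] sum_product ..
  finally have "(\<Sum>j<n. \<Sum>j'<n. (cmod (\<Sum>i<n. a i j * cnj (a i j')))\<^sup>2) \<le> 9 * n + t * (20 * X)"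
    using mult_left_mono[OF R2, of t] by simp
  \<comment> \<open>From \<open>n \<le> 2 * X\<close> and \<open>t \<ge> 1\<close>; together with 20
    this makes 38.\<close>
  also have "9 * n \<le> t * (18 * X)"
  proof -
    have "0 \<le> X" by (simp add: X_def)
    then have "18 * X \<le> t * (18 * X)" using t mult_right_mono[of 1 t "18 * X"] by simp
    then show ?thesis using nQ QX by linarith
  qed
  finally have F: "(\<Sum>j<n. \<Sum>j'<n. (cmod (\<Sum>i<n. a i j * cnj (a i j')))\<^sup>2) \<le> 38 * t * X"
    by (simp add: mult_ac)
  obtain L c where L: "finite L" "card L = vec_space.rank n A"
    and fac: "\<And>i j. i < n \<Longrightarrow> j < n \<Longrightarrow> A $$ (i, j) = (\<Sum>v\<in>L. v $ i * c v j)"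
    using low_rank_factorization[OF A] by metis
  \<comment> \<open>Row factors go into the vectors and column factors into the coefficients, so
    \<open>L\<close> stays the same.\<close>
  have "a i j = (\<Sum>v\<in>L. (of_real (exp (x i / 2)) * v $ i) * (c v j * of_real (exp (y j / 2))))"
    if "i \<in> {..<n}" "j \<in> {..<n}" for i j
    using that by (simp add: a_def fac sum_distrib_left sum_distrib_right mult_ac)
  note ineq = trace_sq_le_rank_frobenius[where a = a, OF L(1) finite_lessThan this]
  have "real n / 2 \<le> (\<Sum>j<n. C j)"
    using sum_mono[of "{..<n}" "\<lambda>_. 1 / 2" C] C by simp
  then have "(real n / 2)\<^sup>2 \<le> (\<Sum>j<n. C j)\<^sup>2"
    by (intro power_mono) auto
  also have "\<dots> \<le> mat_rank A * (38 * t * X)"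
    using order_trans[OF ineq mult_left_mono[OF F]] L(2) A by (simp add: C_def)
  \<comment> \<open>Here \<open>152 = 4 * 38\<close>, the 4 coming from the square of
    \<open>n / 2\<close>.\<close>
  finally have "(real n)\<^sup>2 * (real k)\<^sup>2 \<le> (real n)\<^sup>2 * (152 * (real t)\<^sup>2 * mat_rank A)"
    using k by (simp add: X_def field_simps power2_eq_square)
  then show "(real k)\<^sup>2 \<le> 152 * (real t)\<^sup>2 * mat_rank A"
    using n by simp
qed

theorem theorem4p1:
  shows "\<exists>c::real. c > 0 \<and>
    (\<forall>(n::nat) (q::nat) (k::nat) (t::nat) (A::complex mat).
       n \<ge> 1 \<longrightarrow> A \<in> carrier_mat n n \<longrightarrow>
       q \<ge> 1 \<longrightarrow> k \<ge> 1 \<longrightarrow> t \<ge> 1 \<longrightarrow>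
       design_matrix q k t A \<longrightarrow>
       real (mat_rank A) \<ge> c * (real k ^ 4 / (real n * real t ^ 3)))"
proof (intro exI[of _ "1 / 304"] conjI allI impI)
  fix n q k t :: nat and A :: "complex mat"
  assume *: "n \<ge> 1" "A \<in> carrier_mat n n" "q \<ge> 1" "k \<ge> 1" "t \<ge> 1" "design_matrix q k t A"
  note b = design_matrix_rank_bound[OF *(2,6,1,4,5)]
  \<comment> \<open>Multiplying the two bounds on \<open>k^2\<close> yields the constant
    \<open>304 = 2 * 152\<close>.\<close>
  have "real k ^ 4 = (real k)\<^sup>2 * (real k)\<^sup>2" by (simp flip: power_add)
  also have "\<dots> \<le> (2 * n * t) * (152 * (real t)\<^sup>2 * mat_rank A)"
    by (intro mult_mono b) auto
  also have "\<dots> = 304 * mat_rank A * (real n * real t ^ 3)"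
    by (simp add: power2_eq_square power3_eq_cube)
  finally show "1 / 304 * (real k ^ 4 / (real n * real t ^ 3)) \<le> real (mat_rank A)"
    using *(1,5) by (simp add: pos_divide_le_eq)
qed simp

end
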